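(* Let $R=\mathbb C^2=\mathbb C\varepsilon_1\oplus\mathbb C\varepsilon_2$ with primitive idempotents $\varepsilon_1,\varepsilon_2$, let $a,b\in\mathbb C^\times$, and on the vertex set $V=\{1,2,3,4\}$ define symmetric weights ($w_{ij}=w_{ji}$, $w_{ii}=0$) by $$w_{12}=w_{13}=a\varepsilon_1,\qquad w_{23}=a\varepsilon_1+b\varepsilon_2,\qquad w_{24}=w_{34}=b\varepsilon_2,\qquad w_{14}=0 .$$ Then the total support graph (edges $\{i,j\}$ with $w_{ij}\neq0$) is the diamond graph $K_4\setminus\{\{1,4\}\}$, which is neither a matching nor a clique, and the graph bracket $[f,g]_i=\sum_j w_{ij}(f_ig_j-f_jg_i)$ on $R^V$ satisfies the Jacobi identity. The incident-annihilation condition ($w_{ij}w_{ik}=0$ for all $i$ and all $j\neq k$) fails.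
   Context: $\mathbb C^2$ carries componentwise multiplication, so $\varepsilon_\alpha\varepsilon_\beta=\delta_{\alpha\beta}\varepsilon_\alpha$. The Jacobi identity is $[f,[g,h]]+[g,[h,f]]+[h,[f,g]]=0$ for all $f,g,h\in R^V$. *)

theory Defs
  imports "HOL-Analysis.Analysis"
begin

text \<open>
  The ring \<open>\<complex>\<^sup>2\<close> is the type \<open>complex ^ 2\<close>, whose library ring structure is componentwise,
  and \<open>R\<^sup>V\<close> is \<open>'r ^ 'v\<close>. The elements of the numeral index types \<open>2\<close> and \<open>4\<close> are the
  distinct numerals \<open>1, 2\<close> and \<open>1, 2, 3, 4\<close>, the last one coinciding with \<open>0\<close>.
\<close>

definition prim_idem :: "2 \<Rightarrow> complex ^ 2" where
  "prim_idem \<alpha> = axis \<alpha> 1"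

lemma prim_idem_mult:
  "prim_idem \<alpha> * prim_idem \<beta> = (if \<alpha> = \<beta> then prim_idem \<alpha> else 0)"
  by (auto simp: prim_idem_def vec_eq_iff axis_def)

text \<open>
  Graphs on the vertex type \<open>'v\<close> are given by their sets of edges, an edge being an unordered pair
  \<open>{i, j}\<close>. The weights below vanish on the diagonal, so their support graph has no loops.
\<close>

definition support_edges :: "('v \<Rightarrow> 'v \<Rightarrow> 'r::zero) \<Rightarrow> 'v set set" where
  "support_edges w = {{i, j} | i j. w i j \<noteq> 0}"

definition complete_edges :: "'v set \<Rightarrow> 'v set set" where
  "complete_edges V = {{i, j} | i j. i \<in> V \<and> j \<in> V \<and> i \<noteq> j}"

definition is_matching :: "'v set set \<Rightarrow> bool" where
  "is_matching E \<longleftrightarrow> pairwise disjnt E"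

definition is_clique :: "'v set \<Rightarrow> 'v set set \<Rightarrow> bool" where
  "is_clique V E \<longleftrightarrow> E = complete_edges V"

definition graph_bracket ::
  "('v::finite \<Rightarrow> 'v \<Rightarrow> 'r::comm_ring_1) \<Rightarrow> 'r ^ 'v \<Rightarrow> 'r ^ 'v \<Rightarrow> 'r ^ 'v" where
  "graph_bracket w f g = (\<chi> i. \<Sum>j\<in>UNIV. w i j * (f $ i * g $ j - f $ j * g $ i))"

definition jacobi_identity :: "('m::ab_group_add \<Rightarrow> 'm \<Rightarrow> 'm) \<Rightarrow> bool" where
  "jacobi_identity br \<longleftrightarrow>
     (\<forall>f g h. br f (br g h) + br g (br h f) + br h (br f g) = 0)"

definition incident_annihilation :: "('v \<Rightarrow> 'v \<Rightarrow> 'r::comm_ring_1) \<Rightarrow> bool" where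
  "incident_annihilation w \<longleftrightarrow> (\<forall>i j k. j \<noteq> k \<longrightarrow> w i j * w i k = 0)"

end

theory Submission
  imports Defs
begin

text \<open>
  Over each of the two factors of \<open>\<complex>\<^sup>2\<close> the weight is constant on the pairs of distinct vertices of a
  triangle, \<open>{1, 2, 3}\<close> resp. \<open>{2, 3, 4}\<close>, and zero elsewhere. Writing \<open>U f\<close> for the sum of \<open>f\<close> over
  the triangle, the bracket is \<open>[f, g]\<^sub>i = c (f\<^sub>i U g - U f g\<^sub>i)\<close> there, so \<open>U [f, g] = 0\<close>, and the
  double brackets \<open>[f, [g, h]]\<^sub>i = - c\<^sup>2 U f (g\<^sub>i U h - U g h\<^sub>i)\<close> cancel cyclically.
\<close>

text \<open>The diagonal weights are irrelevant, since \<open>f\<^sub>i g\<^sub>j - f\<^sub>j g\<^sub>i\<close> vanishes for \<open>i = j\<close>.\<close>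

lemma graph_bracket_rank_one:
  fixes w :: "'v::finite \<Rightarrow> 'v \<Rightarrow> 'r::comm_ring_1"
  assumes "\<And>i j. i \<noteq> j \<Longrightarrow> w i j = c * u i * u j"
  shows "graph_bracket w f g $ i =
    c * u i * (f $ i * (\<Sum>j\<in>UNIV. u j * g $ j) - (\<Sum>j\<in>UNIV. u j * f $ j) * g $ i)"
proof -
  have "w i j * (f $ i * g $ j - f $ j * g $ i) =
      c * u i * (f $ i * (u j * g $ j) - u j * f $ j * g $ i)" for j
    using assms[of i j] by (cases "i = j") (auto simp: algebra_simps)
  then have "graph_bracket w f g $ i =
      (\<Sum>j\<in>UNIV. c * u i * (f $ i * (u j * g $ j) - u j * f $ j * g $ i))"
    by (simp only: graph_bracket_def vec_lambda_beta)
  then show ?thesis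
    by (simp add: sum_distrib_left sum_distrib_right sum_subtractf right_diff_distrib)
qed

text \<open>Idempotence of the \<open>u i\<close> is what makes \<open>U\<close> kill every bracket.
  Each double bracket then keeps only one of its two terms, and the common factor
  \<open>c * u i\<close> squared comes out of the cyclic sum.\<close>

lemma jacobi_identity_rank_one:
  fixes w :: "'v::finite \<Rightarrow> 'v \<Rightarrow> 'r::comm_ring_1"
  assumes w: "\<And>i j. i \<noteq> j \<Longrightarrow> w i j = c * u i * u j"
    and idem: "\<And>i. u i * u i = u i"
  shows "jacobi_identity (graph_bracket w)"
proof -
  define U where "U f = (\<Sum>j\<in>UNIV. u j * f $ j)" for f
  have br: "graph_bracket w f g $ i = c * u i * (f $ i * U g - U f * g $ i)" for f g i
    unfolding U_def using w by (rule graph_bracket_rank_one)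
  have "U (graph_bracket w f g) = 0" for f g
  proof -
    have "u j * graph_bracket w f g $ j = c * (u j * f $ j * U g - U f * (u j * g $ j))" for j
    proof -
      \<comment> \<open>Collapsing \<open>u j * u j\<close> to \<open>u j\<close> turns the sum over
        \<open>j\<close> into a multiple of \<open>U f * U g - U f * U g\<close>.\<close>
      have "u j * graph_bracket w f g $ j = c * (u j * u j) * (f $ j * U g - U f * g $ j)"
        by (simp add: br mult_ac)
      also have "\<dots> = c * (u j * f $ j * U g - U f * (u j * g $ j))"
        unfolding idem by (simp add: algebra_simps)
      finally show ?thesis .
    qed
    then have "U (graph_bracket w f g) =
        c * ((\<Sum>j\<in>UNIV. u j * f $ j) * U g - U f * (\<Sum>j\<in>UNIV. u j * g $ j))"
      by (simp add: U_def[of "graph_bracket w f g"] sum_distrib_left sum_distrib_right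
          sum_subtractf right_diff_distrib)
    then show ?thesis
      by (simp flip: U_def)
  qed
  then show ?thesis
    by (simp add: jacobi_identity_def vec_eq_iff br algebra_simps)
qed

text \<open>The coordinate projections are ring homomorphisms, so they commute with the brackets,
  and jointly they are injective.\<close>

lemma jacobi_identity_componentwise:
  fixes w :: "'v::finite \<Rightarrow> 'v \<Rightarrow> 'r::comm_ring_1 ^ 'n"
  assumes "\<And>\<alpha>. jacobi_identity (graph_bracket (\<lambda>i j. w i j $ \<alpha>))"
  shows "jacobi_identity (graph_bracket w)"
proof -
  define P :: "'n \<Rightarrow> ('r ^ 'n) ^ 'v \<Rightarrow> 'r ^ 'v" where "P \<alpha> f = (\<chi> i. f $ i $ \<alpha>)" for \<alpha> f
  have br: "P \<alpha> (graph_bracket w f g) = graph_bracket (\<lambda>i j. w i j $ \<alpha>) (P \<alpha> f) (P \<alpha> g)" for \<alpha> f g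
    by (simp add: P_def graph_bracket_def vec_eq_iff)
  have add: "P \<alpha> (f + g) = P \<alpha> f + P \<alpha> g" for \<alpha> f g
    by (simp add: P_def vec_eq_iff)
  have zero: "f = 0" if "\<And>\<alpha>. P \<alpha> f = 0" for f
    using that by (simp add: P_def vec_eq_iff)
  show ?thesis
    unfolding jacobi_identity_def
    using assms by (intro allI zero) (simp add: add br jacobi_identity_def)
qed

theorem proposition2p4:
  fixes a b :: complex and w :: "4 \<Rightarrow> 4 \<Rightarrow> complex ^ 2"
  assumes "a \<noteq> 0" and "b \<noteq> 0"
    and "\<And>i j. w i j = w j i" and "\<And>i. w i i = 0"
    and "w 1 2 = a *s prim_idem 1" and "w 1 3 = a *s prim_idem 1"
    and "w 2 3 = a *s prim_idem 1 + b *s prim_idem 2"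
    and "w 2 4 = b *s prim_idem 2" and "w 3 4 = b *s prim_idem 2"
    and "w 1 4 = 0"
  shows "support_edges w = complete_edges UNIV - {{1, 4}}
    \<and> \<not> is_matching (support_edges w)
    \<and> \<not> is_clique UNIV (support_edges w)
    \<and> jacobi_identity (graph_bracket w)
    \<and> \<not> incident_annihilation w"
proof -
  have sym: "w 2 1 = w 1 2" "w 3 1 = w 1 3" "w 3 2 = w 2 3" "w 4 2 = w 2 4" "w 4 3 = w 3 4"
    "w 4 1 = w 1 4"
    using assms(3) by blast+
  note weights = sym assms(4-10)
  have idem_nth: "prim_idem \<alpha> $ \<beta> = (if \<beta> = \<alpha> then 1 else 0)" for \<alpha> \<beta>
    by (simp add: prim_idem_def axis_def)
  have nz: "w i j \<noteq> 0 \<longleftrightarrow> i \<noteq> j \<and> {i, j} \<noteq> {1, 4}" for i j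
    using exhaust_4[of i] exhaust_4[of j] assms(1,2)
    by (auto simp: weights vec_eq_iff forall_2 idem_nth doubleton_eq_iff)
  have support: "support_edges w = complete_edges UNIV - {{1, 4}}"
    by (auto simp: support_edges_def complete_edges_def nz)
  have edges: "{1, 2} \<in> support_edges w" "{1, 3} \<in> support_edges w"
    unfolding support_edges_def using nz[of 1 2] nz[of 1 3] by (auto simp: doubleton_eq_iff)
  \<comment> \<open>A matching constrains only distinct edges; these two share the vertex 1.\<close>
  have "{1, 2} \<noteq> {1, 3::4}"
    by (simp add: doubleton_eq_iff)
  then have matching: "\<not> is_matching (support_edges w)"
    using pairwiseD[of disjnt, OF _ edges] by (auto simp: is_matching_def disjnt_def)
  \<comment> \<open>Removing \<open>{1, 4}\<close> leaves a proper subset only because it is a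
    member.\<close>
  have "{1, 4} \<in> complete_edges (UNIV :: 4 set)"
    unfolding complete_edges_def by (force simp: doubleton_eq_iff)
  then have clique: "\<not> is_clique UNIV (support_edges w)"
    by (auto simp: is_clique_def support)
  have jacobi: "jacobi_identity (graph_bracket w)"
  proof (rule jacobi_identity_componentwise)
    fix \<alpha> :: 2
    \<comment> \<open>\<open>u\<close> is the indicator of the triangle belonging to the factor
      \<open>\<alpha>\<close>, which omits vertex 4 for the first factor and vertex 1 for the
      second; \<open>c\<close> is the constant weight on it.\<close>
    define c where "c = (if \<alpha> = 1 then a else b)"
    define u :: "4 \<Rightarrow> complex" where "u i = (if i = (if \<alpha> = 1 then 4 else 1) then 0 else 1)" for i
    have "w i j $ \<alpha> = c * u i * u j" if "i \<noteq> j" for i j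
      using that exhaust_4[of i] exhaust_4[of j] exhaust_2[of \<alpha>]
      by (auto simp: weights c_def u_def idem_nth)
    moreover have "u i * u i = u i" for i
      by (simp add: u_def)
    ultimately show "jacobi_identity (graph_bracket (\<lambda>i j. w i j $ \<alpha>))"
      by (rule jacobi_identity_rank_one)
  qed
  \<comment> \<open>This product is \<open>a\<close> squared times the first idempotent.\<close>
  have "w 1 2 * w 1 3 \<noteq> 0"
    using assms(1) by (auto simp: weights vec_eq_iff forall_2 idem_nth)
  moreover have "(2::4) \<noteq> 3"
    by simp
  ultimately have "\<not> incident_annihilation w"
    unfolding incident_annihilation_def by blast
  with support matching clique jacobi show ?thesis
    by blast
qed

end
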